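(* Let $G\leq \mathrm{Sym}(V)$ and $H\leq \mathrm{Sym}(W)$ be transitive permutation groups on finite sets, and let $G\times H$ act on $V\times W$ by $(g,h)\colon (v,w)\mapsto (g(v),h(w))$. Then (i) $\rho(G\times H)=\rho(G)\rho(H)$, and (ii) $G\times H$ has the strict-EKR-property if and only if both $G$ and $H$ have the strict-EKR-property.
   Context: For a permutation group $K$ acting on a set $X$, a subset $I\subseteq K$ is intersecting if for all $g,h\in I$ there is $x\in X$ with $g(x)=h(x)$. For transitive $K$, the intersection density is $\rho(K)=\max |I|/|K_x|$, the maximum over intersecting sets $I$, where $K_x$ is a point stabilizer. $K$ has the strict-EKR-property if every intersecting set of maximum size in $K$ is a coset of a point stabilizer. *)

theory Defs
  imports Complex_Main "HOL-Algebra.Group_Action"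
begin

text \<open>
  The notions below are stated for an action \<open>\<phi>\<close> of a group \<open>K\<close> on a set \<open>X\<close>, as in
  \<^locale>\<open>group_action\<close>. For a permutation group \<open>K\<close> on \<open>X\<close> the action \<open>\<phi>\<close> is \<open>id\<close>.
\<close>

definition perm_group :: "'a set \<Rightarrow> ('a \<Rightarrow> 'a) set \<Rightarrow> ('a \<Rightarrow> 'a) monoid"
  where "perm_group X K = BijGroup X\<lparr>carrier := K\<rparr>"

text \<open>Outside \<open>X \<times> Y\<close> the value is \<open>undefined\<close>, because members of \<^const>\<open>Bij\<close> are extensional.\<close>

definition prod_action ::
    "'x set \<Rightarrow> ('g \<Rightarrow> 'x \<Rightarrow> 'x) \<Rightarrow> 'y set \<Rightarrow> ('h \<Rightarrow> 'y \<Rightarrow> 'y) \<Rightarrow> 'g \<times> 'h \<Rightarrow> 'x \<times> 'y \<Rightarrow> 'x \<times> 'y"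
  where "prod_action X \<phi> Y \<psi> = (\<lambda>(g, h). \<lambda>(x, y) \<in> X \<times> Y. (\<phi> g x, \<psi> h y))"

definition intersecting ::
    "('g, 'm) monoid_scheme \<Rightarrow> 'x set \<Rightarrow> ('g \<Rightarrow> 'x \<Rightarrow> 'x) \<Rightarrow> 'g set \<Rightarrow> bool"
  where "intersecting K X \<phi> I \<longleftrightarrow>
    I \<subseteq> carrier K \<and> (\<forall>g\<in>I. \<forall>h\<in>I. \<exists>x\<in>X. \<phi> g x = \<phi> h x)"

definition max_intersecting ::
    "('g, 'm) monoid_scheme \<Rightarrow> 'x set \<Rightarrow> ('g \<Rightarrow> 'x \<Rightarrow> 'x) \<Rightarrow> 'g set \<Rightarrow> bool"
  where "max_intersecting K X \<phi> I \<longleftrightarrow>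
    intersecting K X \<phi> I \<and> (\<forall>J. intersecting K X \<phi> J \<longrightarrow> card J \<le> card I)"

text \<open>
  For a transitive action of a finite group all point stabilizers have the same order, so the
  choice of the point is immaterial; see \<open>intersection_density_eq\<close> below.
\<close>

definition intersection_density ::
    "('g, 'm) monoid_scheme \<Rightarrow> 'x set \<Rightarrow> ('g \<Rightarrow> 'x \<Rightarrow> 'x) \<Rightarrow> real"
  where "intersection_density K X \<phi> =
    real (Max {card I |I. intersecting K X \<phi> I}) /
    real (card (stabilizer K \<phi> (SOME x. x \<in> X)))"

text \<open>
  Left cosets suffice: the right coset \<open>K\<^sub>x g\<close> is the left coset \<open>g K\<^sub>y\<close> with \<open>y = g\<^sup>-\<^sup>1 x\<close>.
\<close>

definition strict_EKR ::
    "('g, 'm) monoid_scheme \<Rightarrow> 'x set \<Rightarrow> ('g \<Rightarrow> 'x \<Rightarrow> 'x) \<Rightarrow> bool"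
  where "strict_EKR K X \<phi> \<longleftrightarrow>
    (\<forall>I. max_intersecting K X \<phi> I \<longrightarrow>
      (\<exists>g\<in>carrier K. \<exists>x\<in>X. I = g <#\<^bsub>K\<^esub> stabilizer K \<phi> x))"

lemma (in transitive_action) intersection_density_eq:
  assumes "finite (carrier G)" "x \<in> E"
  shows "intersection_density G E \<phi> =
    real (Max {card I |I. intersecting G E \<phi> I}) / real (card (stabilizer G \<phi> x))"
proof -
  define y where "y = (SOME x. x \<in> E)"
  have y: "y \<in> E"
    using assms(2) unfolding y_def by (rule someI)
  have orb: "orbit G \<phi> z = E" if "z \<in> E" for z
    using that unique_orbit element_image unfolding orbit_def by blast
  have os: "card (orbit G \<phi> z) * card (stabilizer G \<phi> z) = order G" if "z \<in> E" for z
    using that by (rule orbit_stabilizer_theorem)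
  interpret group G
    using group_hom group_hom.axioms(1) by blast
  have "order G > 0"
    using assms(1) by (simp add: order_gt_0_iff_finite)
  then have "card E \<noteq> 0"
    using os[OF assms(2)] orb[OF assms(2)] by (metis less_irrefl mult_0)
  then have "card (stabilizer G \<phi> y) = card (stabilizer G \<phi> x)"
    using os[OF assms(2)] orb[OF assms(2)] os[OF y] orb[OF y] by (metis mult_left_cancel)
  then show ?thesis
    by (simp add: intersection_density_def y_def)
qed

lemma perm_group_action:
  assumes "subgroup K (BijGroup X)"
  shows "faithful_action (perm_group X K) X id"
proof -
  have "group (perm_group X K)"
    unfolding perm_group_def using assms group_BijGroup
    by (rule subgroup.subgroup_is_group)
  moreover have "id \<in> hom (perm_group X K) (BijGroup X)"
    using subgroup.subset[OF assms] by (auto simp: hom_def perm_group_def)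
  ultimately show ?thesis
    by (simp add: faithful_action_def faithful_action_axioms_def group_action_def
        group_hom_def group_hom_axioms_def group_BijGroup)
qed

lemma prod_action_transitive:
  assumes "transitive_action K X \<phi>" "transitive_action L Y \<psi>"
  shows "transitive_action (K \<times>\<times> L) (X \<times> Y) (prod_action X \<phi> Y \<psi>)"
proof -
  interpret A: transitive_action K X \<phi> by fact
  interpret B: transitive_action L Y \<psi> by fact
  have gr: "group K" "group L"
    using A.group_hom B.group_hom by (auto simp: group_hom_def)
  have bij: "prod_action X \<phi> Y \<psi> (g, h) \<in> Bij (X \<times> Y)"
    if gh: "g \<in> carrier K" "h \<in> carrier L" for g h
  proof -
    have "bij_betw (map_prod (\<phi> g) (\<psi> h)) (X \<times> Y) (X \<times> Y)"
      using A.bij_prop0[OF gh(1)] B.bij_prop0[OF gh(2)]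
      by (auto simp: Bij_def intro!: bij_betw_map_prod)
    then have "bij_betw (prod_action X \<phi> Y \<psi> (g, h)) (X \<times> Y) (X \<times> Y)"
      by (rule bij_betw_cong[THEN iffD1, rotated]) (auto simp: prod_action_def)
    then show ?thesis
      by (simp add: Bij_def prod_action_def)
  qed
  have "prod_action X \<phi> Y \<psi> (g \<otimes>\<^bsub>K\<^esub> g', h \<otimes>\<^bsub>L\<^esub> h') =
      compose (X \<times> Y) (prod_action X \<phi> Y \<psi> (g, h)) (prod_action X \<phi> Y \<psi> (g', h'))"
    if "g \<in> carrier K" "g' \<in> carrier K" "h \<in> carrier L" "h' \<in> carrier L" for g g' h h'
  proof
    fix p
    show "prod_action X \<phi> Y \<psi> (g \<otimes>\<^bsub>K\<^esub> g', h \<otimes>\<^bsub>L\<^esub> h') p =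
      compose (X \<times> Y) (prod_action X \<phi> Y \<psi> (g, h)) (prod_action X \<phi> Y \<psi> (g', h')) p"
    proof (cases "p \<in> X \<times> Y")
      case True
      then have "\<phi> g' (fst p) \<in> X" "\<psi> h' (snd p) \<in> Y"
        using that A.element_image[of g' "fst p"] B.element_image[of h' "snd p"] by auto
      with True that show ?thesis
        by (auto simp: prod_action_def compose_def A.composition_rule B.composition_rule)
    qed (auto simp: prod_action_def compose_def restrict_def)
  qed
  then have "prod_action X \<phi> Y \<psi> \<in> hom (K \<times>\<times> L) (BijGroup (X \<times> Y))"
    using bij by (auto simp: hom_def BijGroup_def)
  then have "group_action (K \<times>\<times> L) (X \<times> Y) (prod_action X \<phi> Y \<psi>)"
    using gr by (simp add: group_action_def group_hom_def group_hom_axioms_def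
        DirProd_group group_BijGroup)
  moreover have "\<exists>k\<in>carrier (K \<times>\<times> L). prod_action X \<phi> Y \<psi> k p = q"
    if pq: "p \<in> X \<times> Y" "q \<in> X \<times> Y" for p q
  proof -
    obtain g h where "g \<in> carrier K" "\<phi> g (fst p) = fst q" "h \<in> carrier L" "\<psi> h (snd p) = snd q"
      using pq A.unique_orbit[of "fst p" "fst q"] B.unique_orbit[of "snd p" "snd q"] by auto
    then show ?thesis
      using pq by (intro bexI[of _ "(g, h)"]) (auto simp: prod_action_def split_beta)
  qed
  ultimately show ?thesis
    by (simp add: transitive_action_def transitive_action_axioms_def)
qed

end

theory Submission
  imports Defs
begin

text \<open>
  Two pairs agree at a point of \<open>V \<times> W\<close> iff they agree in each component, so a set is intersecting in
  the product iff both of its projections are. Hence every intersecting set lies in the intersecting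
  box spanned by its projections, and the maximum ones are exactly the boxes \<open>A \<times> B\<close> with \<open>A\<close> and \<open>B\<close>
  maximum. Point stabilizers and their cosets are boxes as well.
\<close>

lemma intersecting_prod_iff:
  "intersecting (K \<times>\<times> L) (X \<times> Y) (prod_action X \<phi> Y \<psi>) I \<longleftrightarrow>
    intersecting K X \<phi> (fst ` I) \<and> intersecting L Y \<psi> (snd ` I)"
proof -
  \<comment> \<open>The two coordinates of a witness in \<open>X \<times> Y\<close> can be chosen
    independently, so the existential splits into one for each factor.\<close>
  have agree: "(\<exists>z\<in>X \<times> Y. prod_action X \<phi> Y \<psi> p z = prod_action X \<phi> Y \<psi> q z) \<longleftrightarrow>
      (\<exists>x\<in>X. \<phi> (fst p) x = \<phi> (fst q) x) \<and> (\<exists>y\<in>Y. \<psi> (snd p) y = \<psi> (snd q) y)" for p q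
    by (auto simp: prod_action_def split_beta)
  have carrier: "I \<subseteq> carrier (K \<times>\<times> L) \<longleftrightarrow> fst ` I \<subseteq> carrier K \<and> snd ` I \<subseteq> carrier L"
    by (auto simp: DirProd_def subset_iff mem_Times_iff)
  show ?thesis
    unfolding intersecting_def agree carrier ball_simps ball_conj_distrib by argo
qed

lemma intersecting_Times:
  assumes "intersecting K X \<phi> A" "intersecting L Y \<psi> B"
  shows "intersecting (K \<times>\<times> L) (X \<times> Y) (prod_action X \<phi> Y \<psi>) (A \<times> B)"
  unfolding intersecting_prod_iff
  \<comment> \<open>If one factor is empty, both projections of \<open>A \<times> B\<close> are
    empty, hence trivially intersecting; otherwise they are \<open>A\<close> and
    \<open>B\<close>.\<close>
  using assms by (auto simp: fst_image_times snd_image_times intersecting_def)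

lemma intersecting_finite:
  assumes "finite (carrier K)" "intersecting K X \<phi> I"
  shows "finite I"
  using assms finite_subset by (auto simp: intersecting_def)

lemma max_intersecting_exists:
  assumes "finite (carrier K)"
  obtains I where "max_intersecting K X \<phi> I"
proof -
  have "intersecting K X \<phi> {}"
    by (simp add: intersecting_def)
  \<comment> \<open>\<open>Suc\<close> turns the bound by the order of the group into the strict one
    that \<open>ex_has_greatest_nat\<close> takes.\<close>
  moreover have "card J < Suc (card (carrier K))" if "intersecting K X \<phi> J" for J
    using that assms by (simp add: intersecting_def card_mono less_Suc_eq_le)
  ultimately obtain I where "intersecting K X \<phi> I" "\<forall>J. intersecting K X \<phi> J \<longrightarrow> card J \<le> card I"
    using ex_has_greatest_nat[of "intersecting K X \<phi>" "{}" card] by blast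
  then show thesis
    using that by (simp add: max_intersecting_def)
qed

text \<open>Links the \<open>Max\<close> in \<open>intersection_density\<close> to a chosen maximum
  set. Its size bounds all the others, so \<open>Max\<close> is taken over a finite set.\<close>

lemma Max_card_intersecting:
  assumes "max_intersecting K X \<phi> A"
  shows "Max {card I |I. intersecting K X \<phi> I} = card A"
proof (rule Max_eqI)
  have "{card I |I. intersecting K X \<phi> I} \<subseteq> {..card A}"
    using assms by (auto simp: max_intersecting_def)
  then show "finite {card I |I. intersecting K X \<phi> I}"
    using finite_subset by blast
qed (use assms in \<open>auto simp: max_intersecting_def\<close>)

text \<open>Singletons are intersecting as soon as \<open>X\<close> has a point. Positivity allows
  cancellation in \<open>max_intersecting_prodE\<close>.\<close>

lemma max_intersecting_card_pos:
  assumes "finite (carrier K)" "carrier K \<noteq> {}" "X \<noteq> {}" "max_intersecting K X \<phi> A"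
  shows "card A > 0"
proof -
  obtain k where "k \<in> carrier K"
    using assms(2) by blast
  then have "intersecting K X \<phi> {k}"
    using assms(3) by (auto simp: intersecting_def)
  then have "card {k} \<le> card A"
    using assms(4) by (simp only: max_intersecting_def)
  then show ?thesis
    by simp
qed

lemma card_le_card_projections:
  assumes "finite (fst ` I)" "finite (snd ` I)"
  shows "card I \<le> card (fst ` I) * card (snd ` I)"
  using card_mono[OF _ subset_fst_snd, of I] assms by (simp add: card_cartesian_product)

text \<open>A competitor \<open>J\<close> has intersecting projections, of sizes at most
  \<open>card A\<close> and \<open>card B\<close>, and fits into the box they span.\<close>

lemma max_intersecting_Times:
  assumes "finite (carrier K)" "finite (carrier L)"
    and "max_intersecting K X \<phi> A" "max_intersecting L Y \<psi> B"
  shows "max_intersecting (K \<times>\<times> L) (X \<times> Y) (prod_action X \<phi> Y \<psi>) (A \<times> B)"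
  unfolding max_intersecting_def
proof (intro conjI allI impI)
  show "intersecting (K \<times>\<times> L) (X \<times> Y) (prod_action X \<phi> Y \<psi>) (A \<times> B)"
    using assms by (intro intersecting_Times) (auto simp: max_intersecting_def)
next
  fix J assume "intersecting (K \<times>\<times> L) (X \<times> Y) (prod_action X \<phi> Y \<psi>) J"
  then have J: "intersecting K X \<phi> (fst ` J)" "intersecting L Y \<psi> (snd ` J)"
    by (simp_all add: intersecting_prod_iff)
  have "card J \<le> card (fst ` J) * card (snd ` J)"
    using intersecting_finite[OF assms(1) J(1)] intersecting_finite[OF assms(2) J(2)]
    by (rule card_le_card_projections)
  also have "\<dots> \<le> card A * card B"
    using assms J by (intro mult_le_mono) (auto simp: max_intersecting_def)
  finally show "card J \<le> card (A \<times> B)"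
    by (simp add: card_cartesian_product)
qed

text \<open>This is the equality case of the count: \<open>card A * card B\<close> is at most
  \<open>card I\<close>, which is at most the product of the projection sizes, hence again at most
  \<open>card A * card B\<close>. So \<open>I\<close> fills its box and both projections have
  maximum size.\<close>

lemma max_intersecting_prodE:
  assumes fin: "finite (carrier K)" "finite (carrier L)"
    and ne: "carrier K \<noteq> {}" "carrier L \<noteq> {}" "X \<noteq> {}" "Y \<noteq> {}"
    and I: "max_intersecting (K \<times>\<times> L) (X \<times> Y) (prod_action X \<phi> Y \<psi>) I"
  obtains A B where "I = A \<times> B" "max_intersecting K X \<phi> A" "max_intersecting L Y \<psi> B"
proof -
  obtain A where A: "max_intersecting K X \<phi> A"
    using fin(1) by (rule max_intersecting_exists)
  obtain B where B: "max_intersecting L Y \<psi> B"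
    using fin(2) by (rule max_intersecting_exists)
  have pos: "card A > 0" "card B > 0"
    using max_intersecting_card_pos[OF fin(1) ne(1,3) A] max_intersecting_card_pos[OF fin(2) ne(2,4) B] .
  have int: "intersecting K X \<phi> (fst ` I)" "intersecting L Y \<psi> (snd ` I)"
    using I by (simp_all add: max_intersecting_def intersecting_prod_iff)
  have finI: "finite (fst ` I)" "finite (snd ` I)"
    using intersecting_finite[OF fin(1) int(1)] intersecting_finite[OF fin(2) int(2)] .
  have le: "card (fst ` I) \<le> card A" "card (snd ` I) \<le> card B"
    using A B int by (simp_all add: max_intersecting_def)
  have "card (A \<times> B) \<le> card I"
    using I max_intersecting_Times[OF fin A B] by (simp add: max_intersecting_def)
  then have lower: "card A * card B \<le> card I"
    by (simp add: card_cartesian_product)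
  have upper: "card I \<le> card (fst ` I) * card (snd ` I)"
    using finI by (rule card_le_card_projections)
  \<comment> \<open>Only one projection size at a time is replaced by its upper bound, which leaves
    a common positive factor to cancel.\<close>
  have "card A * card B \<le> card (fst ` I) * card B" "card A * card B \<le> card A * card (snd ` I)"
    using lower upper le by (meson order_trans mult_le_mono order_refl)+
  then have eq: "card (fst ` I) = card A" "card (snd ` I) = card B"
    using pos le by auto
  have "I = fst ` I \<times> snd ` I"
    using finI lower eq by (intro card_seteq subset_fst_snd) (simp_all add: card_cartesian_product)
  moreover have "max_intersecting K X \<phi> (fst ` I)" "max_intersecting L Y \<psi> (snd ` I)"
    using A B int eq by (simp_all add: max_intersecting_def)
  ultimately show thesis
    by (rule that)
qed

text \<open>At a point of \<open>X \<times> Y\<close> the restriction in \<open>prod_action\<close>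
  unfolds, and fixing a pair means fixing each coordinate.\<close>

lemma stabilizer_prod_action:
  assumes "x \<in> X" "y \<in> Y"
  shows "stabilizer (K \<times>\<times> L) (prod_action X \<phi> Y \<psi>) (x, y) = stabilizer K \<phi> x \<times> stabilizer L \<psi> y"
  using assms by (auto simp: stabilizer_def prod_action_def)

lemma l_coset_DirProd:
  "(g, h) <#\<^bsub>K \<times>\<times> L\<^esub> (A \<times> B) = (g <#\<^bsub>K\<^esub> A) \<times> (h <#\<^bsub>L\<^esub> B)"
  by (auto simp: l_coset_def)

text \<open>Numerator and denominator both factor: a product of maximum sets is maximum, and the
  stabilizer of a pair is a product of stabilizers.\<close>

lemma intersection_density_prod:
  assumes fin: "finite (carrier K)" "finite (carrier L)" and ne: "X \<noteq> {}" "Y \<noteq> {}"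
    and K: "transitive_action K X \<phi>" and L: "transitive_action L Y \<psi>"
  shows "intersection_density (K \<times>\<times> L) (X \<times> Y) (prod_action X \<phi> Y \<psi>) =
    intersection_density K X \<phi> * intersection_density L Y \<psi>"
proof -
  obtain A where A: "max_intersecting K X \<phi> A"
    using fin(1) by (rule max_intersecting_exists)
  obtain B where B: "max_intersecting L Y \<psi> B"
    using fin(2) by (rule max_intersecting_exists)
  obtain x y where xy: "x \<in> X" "y \<in> Y"
    using ne by blast
  have "finite (carrier (K \<times>\<times> L))"
    using fin by (simp add: DirProd_def)
  \<comment> \<open>The point chosen by \<open>SOME\<close> in \<open>X \<times> Y\<close> need not
    be the pair of those chosen in \<open>X\<close> and \<open>Y\<close>; by transitivity,
    \<open>intersection_density_eq\<close> moves all three stabilizers to the matching points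
    \<open>(x, y)\<close>, \<open>x\<close> and \<open>y\<close>.\<close>
  then show ?thesis
    using xy
      transitive_action.intersection_density_eq[OF prod_action_transitive[OF K L], of "(x, y)"]
      transitive_action.intersection_density_eq[OF K fin(1) xy(1)]
      transitive_action.intersection_density_eq[OF L fin(2) xy(2)]
    by (simp add: Max_card_intersecting[OF A] Max_card_intersecting[OF B]
        Max_card_intersecting[OF max_intersecting_Times[OF fin A B]]
        stabilizer_prod_action card_cartesian_product)
qed

text \<open>The stabilizer contains the identity. This is what lets equal boxes be compared factor
  by factor below.\<close>

lemma (in group_action) l_coset_stabilizer_nonempty:
  assumes "x \<in> E"
  shows "g <# stabilizer G \<phi> x \<noteq> {}"
  using subgroup.one_closed[OF stabilizer_subgroup[OF assms]] by (auto simp: l_coset_def)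

lemma strict_EKR_prod_iff:
  assumes fin: "finite (carrier K)" "finite (carrier L)" and ne: "X \<noteq> {}" "Y \<noteq> {}"
    and K: "group_action K X \<phi>" and L: "group_action L Y \<psi>"
  shows "strict_EKR (K \<times>\<times> L) (X \<times> Y) (prod_action X \<phi> Y \<psi>) \<longleftrightarrow>
    strict_EKR K X \<phi> \<and> strict_EKR L Y \<psi>"
proof
  assume KL: "strict_EKR (K \<times>\<times> L) (X \<times> Y) (prod_action X \<phi> Y \<psi>)"
  \<comment> \<open>A maximum set of one factor is tested by pairing it with a maximum set of the
    other: their box is maximum, hence a coset, and its sides are cosets.\<close>
  have cosets: "(\<exists>g\<in>carrier K. \<exists>x\<in>X. A = g <#\<^bsub>K\<^esub> stabilizer K \<phi> x) \<and>
      (\<exists>h\<in>carrier L. \<exists>y\<in>Y. B = h <#\<^bsub>L\<^esub> stabilizer L \<psi> y)"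
    if max: "max_intersecting K X \<phi> A" "max_intersecting L Y \<psi> B" for A B
  proof -
    obtain p z where "p \<in> carrier (K \<times>\<times> L)" "z \<in> X \<times> Y"
        "A \<times> B = p <#\<^bsub>K \<times>\<times> L\<^esub> stabilizer (K \<times>\<times> L) (prod_action X \<phi> Y \<psi>) z"
      using KL max_intersecting_Times[OF fin max] unfolding strict_EKR_def by blast
    then obtain g h x y where gh: "g \<in> carrier K" "h \<in> carrier L" "x \<in> X" "y \<in> Y"
        and "A \<times> B = (g, h) <#\<^bsub>K \<times>\<times> L\<^esub> stabilizer (K \<times>\<times> L) (prod_action X \<phi> Y \<psi>) (x, y)"
      by (cases p, cases z) (auto simp: DirProd_def)
    then have "A \<times> B = (g <#\<^bsub>K\<^esub> stabilizer K \<phi> x) \<times> (h <#\<^bsub>L\<^esub> stabilizer L \<psi> y)"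
      by (simp add: stabilizer_prod_action l_coset_DirProd)
    \<comment> \<open>Equal boxes have equal sides because the sides on the right are
      nonempty.\<close>
    then have "A = g <#\<^bsub>K\<^esub> stabilizer K \<phi> x" "B = h <#\<^bsub>L\<^esub> stabilizer L \<psi> y"
      using group_action.l_coset_stabilizer_nonempty[OF K gh(3)]
        group_action.l_coset_stabilizer_nonempty[OF L gh(4)]
      by (auto simp: times_eq_iff)
    with gh show ?thesis
      by blast
  qed
  \<comment> \<open>Fixed partners: \<open>B\<close> serves every maximum set of \<open>K\<close>,
    and \<open>A\<close> every one of \<open>L\<close>.\<close>
  obtain A where A: "max_intersecting K X \<phi> A"
    using fin(1) by (rule max_intersecting_exists)
  obtain B where B: "max_intersecting L Y \<psi> B"
    using fin(2) by (rule max_intersecting_exists)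
  show "strict_EKR K X \<phi> \<and> strict_EKR L Y \<psi>"
    using cosets[OF _ B] cosets[OF A] by (simp add: strict_EKR_def)
next
  assume EKR: "strict_EKR K X \<phi> \<and> strict_EKR L Y \<psi>"
  have "group K" "group L"
    using K L by (simp_all add: group_action_def group_hom_def)
  then have carrier_ne: "carrier K \<noteq> {}" "carrier L \<noteq> {}"
    using group.is_monoid monoid.one_closed by fastforce+
  show "strict_EKR (K \<times>\<times> L) (X \<times> Y) (prod_action X \<phi> Y \<psi>)"
    unfolding strict_EKR_def
  proof (intro allI impI)
    fix I assume "max_intersecting (K \<times>\<times> L) (X \<times> Y) (prod_action X \<phi> Y \<psi>) I"
    with fin carrier_ne ne obtain A B
      where I: "I = A \<times> B" "max_intersecting K X \<phi> A" "max_intersecting L Y \<psi> B"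
      by (rule max_intersecting_prodE)
    obtain g x where "g \<in> carrier K" "x \<in> X" "A = g <#\<^bsub>K\<^esub> stabilizer K \<phi> x"
      using EKR I(2) unfolding strict_EKR_def by blast
    moreover obtain h y where "h \<in> carrier L" "y \<in> Y" "B = h <#\<^bsub>L\<^esub> stabilizer L \<psi> y"
      using EKR I(3) unfolding strict_EKR_def by blast
    ultimately show "\<exists>p\<in>carrier (K \<times>\<times> L). \<exists>z\<in>X \<times> Y.
        I = p <#\<^bsub>K \<times>\<times> L\<^esub> stabilizer (K \<times>\<times> L) (prod_action X \<phi> Y \<psi>) z"
      using I(1) by (intro bexI[of _ "(g, h)"] bexI[of _ "(x, y)"])
        (simp_all add: stabilizer_prod_action l_coset_DirProd)
  qed
qed

text \<open>Members of \<open>Bij X\<close> are extensional, so they lie in the finite space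
  \<open>X \<rightarrow>\<^sub>E X\<close> even when the underlying type is infinite.\<close>

lemma finite_carrier_perm_group:
  assumes "finite X" "subgroup K (BijGroup X)"
  shows "finite (carrier (perm_group X K))"
proof -
  have "K \<subseteq> Bij X"
    using subgroup.subset[OF assms(2)] by (simp add: BijGroup_def)
  also have "Bij X \<subseteq> X \<rightarrow>\<^sub>E X"
    using Bij_imp_funcset Bij_imp_extensional by (auto simp only: PiE_def)
  finally have "finite K"
    by (rule finite_subset) (simp add: assms(1) finite_PiE)
  then show ?thesis
    by (simp add: perm_group_def)
qed

theorem theorem3p5:
  fixes V :: "'a set" and W :: "'b set"
    and G :: "('a \<Rightarrow> 'a) set" and H :: "('b \<Rightarrow> 'b) set"
  assumes "finite V" "V \<noteq> {}" "finite W" "W \<noteq> {}"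
    and "subgroup G (BijGroup V)" "subgroup H (BijGroup W)"
    and "transitive_action (perm_group V G) V id"
    and "transitive_action (perm_group W H) W id"
  shows "intersection_density (perm_group V G \<times>\<times> perm_group W H) (V \<times> W) (prod_action V id W id) =
      intersection_density (perm_group V G) V id * intersection_density (perm_group W H) W id \<and>
    (strict_EKR (perm_group V G \<times>\<times> perm_group W H) (V \<times> W) (prod_action V id W id) \<longleftrightarrow>
      strict_EKR (perm_group V G) V id \<and> strict_EKR (perm_group W H) W id)"
  using assms finite_carrier_perm_group[OF assms(1,5)] finite_carrier_perm_group[OF assms(3,6)]
  by (simp add: intersection_density_prod strict_EKR_prod_iff transitive_action.axioms(1))

end
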